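(* Assume (A1) below and let $T>0$, $(x_0,y_0)\in\mathcal D$. Consider the problem $$\mathcal P:\quad \inf_{u(\cdot)\in\mathcal U}\Big(\max_{t\in[0,T]}y(t)\Big)$$ where $(x(\cdot),y(\cdot))$ is the solution of $\dot x=f(x,y,u)$, $\dot y=g(x,y,u)$, $(x(0),y(0))=(x_0,y_0)$, and the problem $$\mathcal P_1:\quad \inf_{(u(\cdot),v(\cdot))\in\mathcal U\times\mathcal V} z(T)\quad\text{under the constraint } z(t)-y(t)\ge 0,\ t\in[0,T],$$ where $(x(\cdot),y(\cdot),z(\cdot))$ is the solution of $$\dot x=f(x,y,u),\qquad \dot y=g(x,y,u),\qquad \dot z=\max(g(x,y,u),0)(1-v),\qquad (x(0),y(0),z(0))=(x_0,y_0,y_0).$$ (1) If $(u^\star(\cdot),v^\star(\cdot))$ is optimal for $\mathcal P_1$, then $u^\star(\cdot)$ is optimal for $\mathcal P$. (2) Conversely, if $u^\star(\cdot)$ is optimal for $\mathcal P$, then $(u^\star(\cdot),v^\star(\cdot))$ is optimal for $\mathcal P_1$, where $v^\star(\cdot)$ is any optimal control for the problem, with the control $u(\cdot)=u^\star(\cdot)$ fixed, $$\inf_{v(\cdot)\in\mathcal V} z(T)\quad\text{under the constraint } z(t)-y(t)\ge 0,\ t\in[0,T].$$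
   Context: Setting. Let $\mathcal D\subset\mathbb R^{n+1}$ be a domain and $U\subset\mathbb R^p$ (non-empty). Let $f:\mathcal D\times U\to\mathbb R^n$ and $g:\mathcal D\times U\to\mathbb R$ define the controlled system $$\dot x=f(x,y,u),\qquad \dot y=g(x,y,u),\qquad (x,y)\in\mathcal D,\ u\in U,$$ and assume that $\mathcal D$ is invariant for this system (solutions starting in $\mathcal D$ stay in $\mathcal D$, whatever the control). Assumption (A1): (i) $U$ is compact; (ii) $f$ and $g$ are $C^1$ on $\mathcal D\times U$; (iii) $f,g$ have linear growth: there is $C>0$ with $\|f(x,y,u)\|+|g(x,y,u)|\le C(1+\|x\|+|y|)$ for all $(x,y)\in\mathcal D$, $u\in U$. Notation. $\mathcal U$ is the set of measurable functions $u(\cdot):[0,T]\to U$ and $\mathcal V$ is the set of measurable functions $v(\cdot):[0,T]\to[0,1]$. Solutions are absolutely continuous functions satisfying the equations for a.e. $t$; under (A1) they exist on $[0,T]$ and are unique for each choice of controls and initial condition. A control (pair) is optimal if it is admissible (satisfies the constraint, if any) and attains the infimum. *)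

theory Defs
  imports "HOL-Analysis.Analysis"
begin

(* Continuous differentiability on a set that need not be open (here D \<times> U with U compact):
   the map is the restriction of a continuously differentiable map on an open neighbourhood. *)
definition C1_on :: "('a::real_normed_vector \<Rightarrow> 'b::real_normed_vector) \<Rightarrow> 'a set \<Rightarrow> bool" where
  "C1_on h S \<longleftrightarrow>
     (\<exists>W H H'. open W \<and> S \<subseteq> W \<and> (\<forall>p\<in>S. H p = h p) \<and>
        (\<forall>p\<in>W. (H has_derivative blinfun_apply (H' p)) (at p)) \<and> continuous_on W H')"

(* The usual epsilon-delta definition; a division of a subset t of S is a finite family of
   compact intervals [Inf k, Sup k] contained in S with pairwise disjoint interiors. *)
definition abs_continuous_on :: "real set \<Rightarrow> (real \<Rightarrow> 'a::real_normed_vector) \<Rightarrow> bool" where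
  "abs_continuous_on S h \<longleftrightarrow>
     (\<forall>\<epsilon>>0. \<exists>\<delta>>0. \<forall>d t. d division_of t \<and> t \<subseteq> S \<and> (\<Sum>k\<in>d. Sup k - Inf k) < \<delta> \<longrightarrow>
        (\<Sum>k\<in>d. norm (h (Sup k) - h (Inf k))) < \<epsilon>)"

(* Controls are total functions; only their values on [0,T] are ever used. *)
definition controls :: "real \<Rightarrow> 'a::topological_space set \<Rightarrow> (real \<Rightarrow> 'a) set" where
  "controls T A = {u \<in> borel_measurable (lebesgue_on {0..T}). \<forall>t\<in>{0..T}. u t \<in> A}"

definition is_solution ::
  "(real^'n \<Rightarrow> real \<Rightarrow> real^'p \<Rightarrow> real^'n) \<Rightarrow> (real^'n \<Rightarrow> real \<Rightarrow> real^'p \<Rightarrow> real) \<Rightarrow> real \<Rightarrow>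
   (real \<Rightarrow> real^'p) \<Rightarrow> (real \<Rightarrow> real^'n) \<Rightarrow> (real \<Rightarrow> real) \<Rightarrow> bool" where
  "is_solution f g T u x y \<longleftrightarrow>
     abs_continuous_on {0..T} x \<and> abs_continuous_on {0..T} y \<and>
     (AE t in lebesgue_on {0..T}.
        (x has_vector_derivative f (x t) (y t) (u t)) (at t within {0..T}) \<and>
        (y has_real_derivative g (x t) (y t) (u t)) (at t within {0..T}))"

(* f and g are total functions, but their values off D \<times> U are irrelevant here: as D is open,
   a solution leaving D has a first exit time \<tau>, and its restriction to [0,\<tau>], whose
   equation holds a.e. with values in D, already violates invariance. *)
definition invariant_domain ::
  "((real^'n) \<times> real) set \<Rightarrow> (real^'p) set \<Rightarrow>
   (real^'n \<Rightarrow> real \<Rightarrow> real^'p \<Rightarrow> real^'n) \<Rightarrow> (real^'n \<Rightarrow> real \<Rightarrow> real^'p \<Rightarrow> real) \<Rightarrow> bool" where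
  "invariant_domain D U f g \<longleftrightarrow>
     (\<forall>\<tau>>0. \<forall>u\<in>controls \<tau> U. \<forall>x y. is_solution f g \<tau> u x y \<and> (x 0, y 0) \<in> D \<longrightarrow>
        (\<forall>t\<in>{0..\<tau>}. (x t, y t) \<in> D))"

definition trajectory ::
  "(real^'n \<Rightarrow> real \<Rightarrow> real^'p \<Rightarrow> real^'n) \<Rightarrow> (real^'n \<Rightarrow> real \<Rightarrow> real^'p \<Rightarrow> real) \<Rightarrow> real \<Rightarrow>
   real^'n \<Rightarrow> real \<Rightarrow> (real \<Rightarrow> real^'p) \<Rightarrow> (real \<Rightarrow> real^'n) \<Rightarrow> (real \<Rightarrow> real) \<Rightarrow> bool" where
  "trajectory f g T x0 y0 u x y \<longleftrightarrow> is_solution f g T u x y \<and> x 0 = x0 \<and> y 0 = y0"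

definition extended_trajectory ::
  "(real^'n \<Rightarrow> real \<Rightarrow> real^'p \<Rightarrow> real^'n) \<Rightarrow> (real^'n \<Rightarrow> real \<Rightarrow> real^'p \<Rightarrow> real) \<Rightarrow> real \<Rightarrow>
   real^'n \<Rightarrow> real \<Rightarrow> (real \<Rightarrow> real^'p) \<Rightarrow> (real \<Rightarrow> real) \<Rightarrow>
   (real \<Rightarrow> real^'n) \<Rightarrow> (real \<Rightarrow> real) \<Rightarrow> (real \<Rightarrow> real) \<Rightarrow> bool" where
  "extended_trajectory f g T x0 y0 u v x y z \<longleftrightarrow>
     trajectory f g T x0 y0 u x y \<and> z 0 = y0 \<and> abs_continuous_on {0..T} z \<and>
     (AE t in lebesgue_on {0..T}.
        (z has_real_derivative max (g (x t) (y t) (u t)) 0 * (1 - v t)) (at t within {0..T}))"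

(* Solutions are unique on [0,T] only, as functions there, so "the" solution of a control enters
   as a relation. A control is optimal if its solution attains the infimum of the cost, i.e. its
   cost is a lower bound of the costs of all (admissible) controls. *)
definition optimal_P ::
  "(real^'p) set \<Rightarrow> (real^'n \<Rightarrow> real \<Rightarrow> real^'p \<Rightarrow> real^'n) \<Rightarrow> (real^'n \<Rightarrow> real \<Rightarrow> real^'p \<Rightarrow> real) \<Rightarrow>
   real \<Rightarrow> real^'n \<Rightarrow> real \<Rightarrow> (real \<Rightarrow> real^'p) \<Rightarrow> bool" where
  "optimal_P U f g T x0 y0 u \<longleftrightarrow>
     u \<in> controls T U \<and>
     (\<exists>x y. trajectory f g T x0 y0 u x y \<and>
        (\<forall>u'\<in>controls T U. \<forall>x' y'. trajectory f g T x0 y0 u' x' y' \<longrightarrow>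
           (SUP t\<in>{0..T}. y t) \<le> (SUP t\<in>{0..T}. y' t)))"

definition admissible_P1 ::
  "(real^'p) set \<Rightarrow> (real^'n \<Rightarrow> real \<Rightarrow> real^'p \<Rightarrow> real^'n) \<Rightarrow> (real^'n \<Rightarrow> real \<Rightarrow> real^'p \<Rightarrow> real) \<Rightarrow>
   real \<Rightarrow> real^'n \<Rightarrow> real \<Rightarrow> (real \<Rightarrow> real^'p) \<Rightarrow> (real \<Rightarrow> real) \<Rightarrow>
   (real \<Rightarrow> real^'n) \<Rightarrow> (real \<Rightarrow> real) \<Rightarrow> (real \<Rightarrow> real) \<Rightarrow> bool" where
  "admissible_P1 U f g T x0 y0 u v x y z \<longleftrightarrow>
     u \<in> controls T U \<and> v \<in> controls T {0..1} \<and>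
     extended_trajectory f g T x0 y0 u v x y z \<and> (\<forall>t\<in>{0..T}. z t - y t \<ge> 0)"

definition optimal_P1 ::
  "(real^'p) set \<Rightarrow> (real^'n \<Rightarrow> real \<Rightarrow> real^'p \<Rightarrow> real^'n) \<Rightarrow> (real^'n \<Rightarrow> real \<Rightarrow> real^'p \<Rightarrow> real) \<Rightarrow>
   real \<Rightarrow> real^'n \<Rightarrow> real \<Rightarrow> (real \<Rightarrow> real^'p) \<Rightarrow> (real \<Rightarrow> real) \<Rightarrow> bool" where
  "optimal_P1 U f g T x0 y0 u v \<longleftrightarrow>
     (\<exists>x y z. admissible_P1 U f g T x0 y0 u v x y z \<and>
        (\<forall>u' v' x' y' z'. admissible_P1 U f g T x0 y0 u' v' x' y' z' \<longrightarrow> z T \<le> z' T))"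

definition optimal_P1_fixed_control ::
  "(real^'p) set \<Rightarrow> (real^'n \<Rightarrow> real \<Rightarrow> real^'p \<Rightarrow> real^'n) \<Rightarrow> (real^'n \<Rightarrow> real \<Rightarrow> real^'p \<Rightarrow> real) \<Rightarrow>
   real \<Rightarrow> real^'n \<Rightarrow> real \<Rightarrow> (real \<Rightarrow> real^'p) \<Rightarrow> (real \<Rightarrow> real) \<Rightarrow> bool" where
  "optimal_P1_fixed_control U f g T x0 y0 u v \<longleftrightarrow>
     (\<exists>x y z. admissible_P1 U f g T x0 y0 u v x y z \<and>
        (\<forall>v' x' y' z'. admissible_P1 U f g T x0 y0 u v' x' y' z' \<longrightarrow> z T \<le> z' T))"

end

(* Every admissible z is nondecreasing and lies above y, so z(T) is at least max y. Conversely, the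
   running maximum m(t) = max {y(s) | s <= t} is an admissible z with m(T) = max y: it is absolutely
   continuous and almost everywhere has derivative max(g,0) (1 - v), where v is the indicator function
   of {y < m}. Hence both problems minimise max y. *)

theory Submission
  imports Defs
begin

section \<open>Exceptional null sets, absolute continuity and monotonicity\<close>

lemma AE_lebesgue_on_iff_negligible:
  assumes "S \<in> sets lebesgue"
  shows "(AE t in lebesgue_on S. P t) \<longleftrightarrow> negligible {t\<in>S. \<not> P t}"
proof -
  have "(AE t in lebesgue_on S. P t) \<longleftrightarrow> (AE t in lebesgue. t \<in> S \<longrightarrow> P t)"
    using assms by (intro AE_restrict_space_iff) auto
  also have "\<dots> \<longleftrightarrow> negligible {t\<in>S. \<not> P t}"
  proof
    assume "AE t in lebesgue. t \<in> S \<longrightarrow> P t"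
    then obtain N where N: "N \<in> null_sets lebesgue" "{t \<in> space lebesgue. \<not> (t \<in> S \<longrightarrow> P t)} \<subseteq> N"
      unfolding eventually_ae_filter by blast
    then have "{t\<in>S. \<not> P t} \<subseteq> N"
      by auto
    moreover have "negligible N"
      using N by (simp only: negligible_iff_null_sets)
    ultimately show "negligible {t\<in>S. \<not> P t}"
      by (rule negligible_subset[rotated])
  next
    assume "negligible {t\<in>S. \<not> P t}"
    then show "AE t in lebesgue. t \<in> S \<longrightarrow> P t"
      by (intro AE_I'[of "{t\<in>S. \<not> P t}"]) (auto simp: negligible_iff_null_sets)
  qed
  finally show ?thesis .
qed

text \<open>Applied to the one-interval division \<open>{{u..v}}\<close>, the definition bounds
  \<open>norm (h v - h u)\<close> as soon as \<open>v - u < \<delta>\<close>.\<close>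

lemma abs_continuous_on_imp_continuous_on:
  fixes h :: "real \<Rightarrow> 'a::real_normed_vector"
  assumes "abs_continuous_on {a..b} h"
  shows "continuous_on {a..b} h"
  unfolding continuous_on_iff
proof (intro ballI allI impI)
  fix s e :: real
  assume s: "s \<in> {a..b}" and "e > 0"
  then obtain \<delta> where "\<delta> > 0" and \<delta>: "\<And>d t. d division_of t \<Longrightarrow> t \<subseteq> {a..b} \<Longrightarrow>
      (\<Sum>k\<in>d. Sup k - Inf k) < \<delta> \<Longrightarrow> (\<Sum>k\<in>d. norm (h (Sup k) - h (Inf k))) < e"
    using assms unfolding abs_continuous_on_def by meson
  have close: "dist (h u) (h v) < e" if "a \<le> u" "u \<le> v" "v \<le> b" "v - u < \<delta>" for u v
  proof -
    have "{{u..v}} division_of {u..v}"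
      using division_of_self[of u v] that by simp
    moreover have "{u..v} \<subseteq> {a..b}"
      using that by auto
    moreover have "(\<Sum>k\<in>{{u..v}}. Sup k - Inf k) < \<delta>"
      using that by simp
    ultimately have "(\<Sum>k\<in>{{u..v}}. norm (h (Sup k) - h (Inf k))) < e"
      by (rule \<delta>)
    then show ?thesis
      using that by (simp add: dist_norm norm_minus_commute)
  qed
  have "dist (h r) (h s) < e" if r: "r \<in> {a..b}" "dist r s < \<delta>" for r
  proof (cases "r \<le> s")
    case True
    then show ?thesis
      using r s close[of r s] by (simp add: dist_real_def)
  next
    case False
    then show ?thesis
      using r s close[of s r] by (simp add: dist_real_def dist_commute)
  qed
  with \<open>\<delta> > 0\<close> show "\<exists>d>0. \<forall>r\<in>{a..b}. dist r s < d \<longrightarrow> dist (h r) (h s) < e"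
    by blast
qed

text \<open>A Cousin argument: in a sufficiently fine tagged division of \<open>{c..d}\<close>, the intervals tagged at
  points of nonnegative derivative contribute at least \<open>- \<epsilon> * (d - c)\<close> to \<open>h d - h c\<close>, while the
  others lie in an open set of small measure, where absolute continuity applies.\<close>

lemma abs_continuous_on_mono:
  fixes h :: "real \<Rightarrow> real"
  assumes ac: "abs_continuous_on {a..b} h"
    and deriv: "AE t in lebesgue_on {a..b}. \<exists>D\<ge>0. (h has_real_derivative D) (at t within {a..b})"
    and cd: "a \<le> c" "c \<le> d" "d \<le> b"
  shows "h c \<le> h d"
proof -
  define N where "N = {t\<in>{a..b}. \<not> (\<exists>D\<ge>0. (h has_real_derivative D) (at t within {a..b}))}"
  have N: "negligible N"
    using deriv unfolding N_def by (subst (asm) AE_lebesgue_on_iff_negligible) auto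
  \<comment> \<open>The term \<open>\<epsilon> * (d - c)\<close> pays for the intervals tagged
    outside \<open>N\<close>, the additional \<open>\<epsilon>\<close> for those tagged in
    \<open>N\<close>.\<close>
  have bound: "h c - h d \<le> \<epsilon> * (d - c) + \<epsilon>" if "\<epsilon> > 0" for \<epsilon>
  proof -
    obtain \<delta> where "\<delta> > 0" and \<delta>: "\<And>d t. d division_of t \<Longrightarrow> t \<subseteq> {a..b} \<Longrightarrow>
        (\<Sum>k\<in>d. Sup k - Inf k) < \<delta> \<Longrightarrow> (\<Sum>k\<in>d. norm (h (Sup k) - h (Inf k))) < \<epsilon>"
      using ac \<open>\<epsilon> > 0\<close> unfolding abs_continuous_on_def by meson
    \<comment> \<open>Outer regularity controls \<open>G - N\<close> only; since \<open>N\<close> is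
      null, \<open>G\<close> itself has measure below \<open>\<delta>\<close>.\<close>
    obtain G where G: "open G" "N \<subseteq> G" "G - N \<in> lmeasurable" "emeasure lebesgue (G - N) < ennreal \<delta>"
      using sets_lebesgue_outer_open[OF negligible_imp_sets[OF N] \<open>\<delta> > 0\<close>] by metis
    have mG: "G \<in> lmeasurable" "measure lebesgue G < \<delta>"
    proof -
      have *: "G = (G - N) \<union> N" using G(2) by blast
      show "G \<in> lmeasurable"
        by (subst *, rule fmeasurable.Un) (use G(3) N in \<open>auto intro: negligible_imp_measurable\<close>)
      have "measure lebesgue G \<le> measure lebesgue (G - N) + measure lebesgue N"
        by (subst *, rule measure_Un_le)
          (use G(3) N in \<open>auto intro: negligible_imp_sets fmeasurableD\<close>)
      also have "\<dots> = measure lebesgue (G - N)"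
        using N by (simp add: negligible_imp_measure0)
      also have "\<dots> < \<delta>"
        using G(3,4) \<open>\<delta> > 0\<close> by (simp add: emeasure_eq_measure2 ennreal_less_iff)
      finally show "measure lebesgue G < \<delta>" .
    qed
    \<comment> \<open>The two sides of the tag are estimated separately: for a tagged interval
      \<open>{u..v}\<close> the bounds on \<open>h v - h t\<close> and \<open>h t - h u\<close> add
      up to a bound on \<open>h v - h u\<close> with error
      \<open>\<epsilon> * (v - u)\<close>.\<close>
    have "\<exists>r>0. t \<in> {a..b} - N \<longrightarrow> (\<forall>s\<in>{a..b}. \<bar>s - t\<bar> < r \<longrightarrow>
        (t \<le> s \<longrightarrow> h s - h t \<ge> - \<epsilon> * (s - t)) \<and> (s \<le> t \<longrightarrow> h t - h s \<ge> - \<epsilon> * (t - s)))" for t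
    proof (cases "t \<in> {a..b} - N")
      case True
      then obtain D where "D \<ge> 0" "(h has_real_derivative D) (at t within {a..b})"
        by (auto simp: N_def)
      then obtain r where "r > 0" and r: "\<And>s. s \<in> {a..b} \<Longrightarrow> \<bar>s - t\<bar> < r \<Longrightarrow>
          \<bar>h s - h t - D * (s - t)\<bar> \<le> \<epsilon> * \<bar>s - t\<bar>"
        using \<open>\<epsilon> > 0\<close> unfolding has_field_derivative_def has_derivative_within_alt real_norm_def by blast
      have "(t \<le> s \<longrightarrow> h s - h t \<ge> - \<epsilon> * (s - t)) \<and> (s \<le> t \<longrightarrow> h t - h s \<ge> - \<epsilon> * (t - s))"
        if "s \<in> {a..b}" "\<bar>s - t\<bar> < r" for s
      proof -
        have "t \<le> s \<Longrightarrow> D * (s - t) \<ge> 0" "s \<le> t \<Longrightarrow> D * (s - t) \<le> 0"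
          using \<open>D \<ge> 0\<close> by (auto intro: mult_nonneg_nonpos)
        then show ?thesis
          using r[OF that] by (auto simp: abs_if algebra_simps split: if_splits)
      qed
      with \<open>r > 0\<close> show ?thesis by blast
    qed (auto intro: exI[of _ 1])
    then obtain r where rpos: "\<And>t. r t > 0" and r: "\<And>t s. t \<in> {a..b} - N \<Longrightarrow> s \<in> {a..b} \<Longrightarrow>
        \<bar>s - t\<bar> < r t \<Longrightarrow> (t \<le> s \<longrightarrow> h s - h t \<ge> - \<epsilon> * (s - t)) \<and> (s \<le> t \<longrightarrow> h t - h s \<ge> - \<epsilon> * (t - s))"
      by metis
    \<comment> \<open>A tag in \<open>N\<close> forces its interval into \<open>G\<close>; any other
      tag forces it into the range of the derivative estimate.\<close>
    define \<gamma> where "\<gamma> t = (if t \<in> N then G else ball t (r t))" for t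
    have "gauge \<gamma>"
      using G rpos by (auto simp: gauge_def \<gamma>_def)
    then obtain p where p: "p tagged_division_of {c..d}" "\<gamma> fine p"
      by (rule fine_division_exists_real)
    have fin: "finite p"
      using p by auto
    have inter: "\<exists>u v. K = {u..v} \<and> u \<le> t \<and> t \<le> v \<and> a \<le> u \<and> v \<le> b" if "(t, K) \<in> p" for t K
      using tagged_division_ofD(2-4)[OF p(1) that] cd by fastforce
    define p1 where "p1 = {(t, K)\<in>p. t \<notin> N}"
    define p2 where "p2 = {(t, K)\<in>p. t \<in> N}"
    have "p = p1 \<union> p2" "p1 \<inter> p2 = {}"
      by (auto simp: p1_def p2_def)
    with fin have split: "p = p1 \<union> p2" "p1 \<inter> p2 = {}" "finite p1" "finite p2"
      by auto
    have sum_split: "sum F p = sum F p1 + sum F p2" for F :: "_ \<Rightarrow> real"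
      using split sum.union_disjoint by metis
    have "(\<Sum>(t, K)\<in>p1. h (Inf K) - h (Sup K)) \<le> (\<Sum>(t, K)\<in>p1. \<epsilon> * (Sup K - Inf K))"
    proof (rule sum_mono, clarify)
      fix t K assume tK: "(t, K) \<in> p1"
      then obtain u v where uv: "K = {u..v}" "u \<le> t" "t \<le> v" "a \<le> u" "v \<le> b" and "(t, K) \<in> p" "t \<notin> N"
        using inter unfolding p1_def by blast
      then have "K \<subseteq> \<gamma> t"
        using p(2) by (auto simp: fine_def)
      then have "K \<subseteq> ball t (r t)"
        using \<open>t \<notin> N\<close> by (simp add: \<gamma>_def)
      moreover have "u \<in> K" "v \<in> K"
        using uv by auto
      ultimately have "u \<in> ball t (r t)" "v \<in> ball t (r t)"
        by blast+
      then have "h v - h t \<ge> - \<epsilon> * (v - t)" "h t - h u \<ge> - \<epsilon> * (t - u)"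
        using r[of t u] r[of t v] uv \<open>t \<notin> N\<close> by (auto simp: dist_real_def)
      then show "h (Inf K) - h (Sup K) \<le> \<epsilon> * (Sup K - Inf K)"
        using uv by (simp add: algebra_simps)
    qed
    \<comment> \<open>Adding the remaining nonnegative terms makes the lengths telescope to
      \<open>d - c\<close>.\<close>
    also have "\<dots> \<le> (\<Sum>(t, K)\<in>p. \<epsilon> * (Sup K - Inf K))"
    proof (rule sum_mono2)
      fix k assume "k \<in> p - p1"
      then have "Inf (snd k) \<le> Sup (snd k)"
        using inter[of "fst k" "snd k"] by auto
      then show "0 \<le> (case k of (t, K) \<Rightarrow> \<epsilon> * (Sup K - Inf K))"
        using \<open>\<epsilon> > 0\<close> by (simp add: case_prod_unfold)
    qed (use fin split in auto)
    also have "\<dots> = \<epsilon> * (\<Sum>(t, K)\<in>p. (Sup K - Inf K))"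
      by (simp add: sum_distrib_left case_prod_unfold)
    also have "(\<Sum>(t, K)\<in>p. (Sup K - Inf K)) = d - c"
      using additive_tagged_division_1[OF cd(2) p(1), of "\<lambda>x. x"] by simp
    finally have 1: "(\<Sum>(t, K)\<in>p1. h (Inf K) - h (Sup K)) \<le> \<epsilon> * (d - c)" .
    define S where "S = \<Union>(snd ` p2)"
    have "p tagged_partial_division_of {c..d}"
      using p(1) by (simp add: tagged_division_of_def)
    then have part: "p2 tagged_partial_division_of {c..d}"
      by (rule tagged_partial_division_subset) (auto simp: p2_def)
    have tag: "p2 tagged_division_of S" and div: "snd ` p2 division_of S"
      using tagged_partial_division_of_Union_self[OF part] partial_division_of_tagged_division[OF part]
      by (simp_all add: S_def)
    have "S \<subseteq> {a..b}"
      using inter by (fastforce simp: S_def p2_def)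
    \<comment> \<open>The intervals do not overlap, so their total length is the measure of
      \<open>S\<close>, and fineness puts \<open>S\<close> inside \<open>G\<close>.\<close>
    moreover have "(\<Sum>K\<in>snd ` p2. Sup K - Inf K) < \<delta>"
    proof -
      have "(\<Sum>K\<in>snd ` p2. Sup K - Inf K) = (\<Sum>K\<in>snd ` p2. measure lebesgue K)"
      proof (rule sum.cong[OF refl])
        fix K assume "K \<in> snd ` p2"
        then show "Sup K - Inf K = measure lebesgue K"
          using inter by (fastforce simp: p2_def)
      qed
      also have "\<dots> = measure lebesgue S"
        by (rule content_division[OF div])
      also have "\<dots> \<le> measure lebesgue G"
      proof (rule measure_mono_fmeasurable)
        show "S \<subseteq> G"
          using p(2) by (fastforce simp: S_def p2_def fine_def \<gamma>_def)
      qed (use lmeasurable_division[OF div] mG in auto)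
      finally show ?thesis using mG by simp
    qed
    ultimately have 2: "(\<Sum>K\<in>snd ` p2. norm (h (Sup K) - h (Inf K))) < \<epsilon>"
      by (rule \<delta>[OF div])
    have ne: "K \<noteq> {}" if "(t, K) \<in> p2" for t K
      using tagged_partial_division_ofD(2)[OF part that] by auto
    \<comment> \<open>Two tags can share an interval only if its interior is empty, so forgetting
      the tags requires a summand that vanishes on every such interval. The explicit 0 settles the
      empty one, where \<open>Inf\<close> and \<open>Sup\<close> give no information.\<close>
    have "(\<Sum>(t, K)\<in>p2. norm (h (Sup K) - h (Inf K))) = (\<Sum>(t, K)\<in>p2. if K = {} then 0 else norm (h (Sup K) - h (Inf K)))"
      using ne by (intro sum.cong) auto
    also have "\<dots> = (\<Sum>K\<in>snd ` p2. if K = {} then 0 else norm (h (Sup K) - h (Inf K)))"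
      by (rule sum.over_tagged_division_lemma[OF tag]) (auto simp: box_real)
    also have "\<dots> = (\<Sum>K\<in>snd ` p2. norm (h (Sup K) - h (Inf K)))"
      using ne by (intro sum.cong) auto
    also note 2
    finally have "(\<Sum>(t, K)\<in>p2. norm (h (Sup K) - h (Inf K))) < \<epsilon>" .
    moreover have "(\<Sum>(t, K)\<in>p2. h (Inf K) - h (Sup K)) \<le> (\<Sum>(t, K)\<in>p2. norm (h (Sup K) - h (Inf K)))"
      by (rule sum_mono) auto
    moreover have "(\<Sum>(t, K)\<in>p. h (Inf K) - h (Sup K)) = h c - h d"
      using additive_tagged_division_1[OF cd(2) p(1), of "\<lambda>x. - h x"] by simp
    ultimately show ?thesis
      using 1 sum_split[of "\<lambda>(t, K). h (Inf K) - h (Sup K)"] by linarith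
  qed
  show ?thesis
  proof (rule ccontr)
    assume "\<not> h c \<le> h d"
    then have "h c - h d > 0" by simp
    \<comment> \<open>With this choice the error in \<open>bound\<close> is exactly half of the
      supposed drop \<open>h c - h d\<close>.\<close>
    define \<epsilon> where "\<epsilon> = (h c - h d) / (2 * (d - c + 1))"
    have "d - c + 1 > 0" using cd by simp
    then have "\<epsilon> > 0" "\<epsilon> * (d - c + 1) = (h c - h d) / 2"
      using \<open>h c - h d > 0\<close> by (auto simp: \<epsilon>_def field_simps)
    then show False
      using bound[of \<epsilon>] \<open>h c - h d > 0\<close> by (simp add: algebra_simps)
  qed
qed

section \<open>The running maximum and its absolute continuity\<close>

text \<open>For \<open>a = 0\<close> and \<open>t = T\<close> this is literally the cost of the
  original problem.\<close>

definition running_max :: "real \<Rightarrow> (real \<Rightarrow> real) \<Rightarrow> real \<Rightarrow> real" where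
  "running_max a y t = (SUP s\<in>{a..t}. y s)"

lemma running_max_attained:
  assumes "continuous_on {a..b} y" "a \<le> t" "t \<le> b"
  obtains s where "s \<in> {a..t}" "running_max a y t = y s"
proof -
  have "continuous_on {a..t} y"
    using assms by (auto intro: continuous_on_subset)
  then obtain s where s: "s \<in> {a..t}" "\<forall>r\<in>{a..t}. y r \<le> y s"
    using continuous_attains_sup[of "{a..t}" y] assms by auto
  then have "running_max a y t = y s"
    unfolding running_max_def by (intro cSup_eq_maximum) auto
  with s show thesis
    by (intro that)
qed

lemma running_max_upper:
  assumes "continuous_on {a..b} y" "s \<in> {a..t}" "t \<le> b"
  shows "y s \<le> running_max a y t"
proof -
  have "continuous_on {a..t} y"
    using assms by (auto intro: continuous_on_subset)
  then have "bdd_above (y ` {a..t})"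
    by (intro bounded_imp_bdd_above compact_imp_bounded compact_continuous_image) auto
  with assms show ?thesis
    unfolding running_max_def by (intro cSUP_upper)
qed

lemma running_max_least:
  assumes "a \<le> t" "\<And>s. s \<in> {a..t} \<Longrightarrow> y s \<le> c"
  shows "running_max a y t \<le> c"
  unfolding running_max_def using assms by (intro cSUP_least) auto

lemma running_max_mono:
  assumes "continuous_on {a..b} y" "a \<le> s" "s \<le> t" "t \<le> b"
  shows "running_max a y s \<le> running_max a y t"
  using assms by (intro running_max_least running_max_upper) auto

text \<open>A maximiser over \<open>{a..t}\<close> at or before \<open>s\<close> would already count
  towards the maximum at \<open>s\<close>.\<close>

lemma running_max_increase:
  assumes "continuous_on {a..b} y" "a \<le> s" "s \<le> t" "t \<le> b" "running_max a y s < running_max a y t"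
  obtains r where "r \<in> {s<..t}" "running_max a y t = y r"
proof -
  obtain r where r: "r \<in> {a..t}" "running_max a y t = y r"
    using running_max_attained[OF assms(1), of t] assms by auto
  moreover have "\<not> r \<le> s"
    using running_max_upper[OF assms(1), of r s] r assms by auto
  ultimately show thesis using that[of r] by auto
qed

text \<open>On an interval where the running maximum increases, its increment is bounded by that of \<open>y\<close>
  on the smaller interval ending where the new maximum is attained.\<close>

lemma abs_continuous_on_running_max:
  assumes ac: "abs_continuous_on {a..b} y"
  shows "abs_continuous_on {a..b} (running_max a y)"
  unfolding abs_continuous_on_def
proof (intro allI impI)
  fix \<epsilon> :: real assume "\<epsilon> > 0"
  then obtain \<delta> where "\<delta> > 0" and \<delta>: "\<And>d t. d division_of t \<Longrightarrow> t \<subseteq> {a..b} \<Longrightarrow>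
      (\<Sum>k\<in>d. Sup k - Inf k) < \<delta> \<Longrightarrow> (\<Sum>k\<in>d. norm (y (Sup k) - y (Inf k))) < \<epsilon>"
    using ac unfolding abs_continuous_on_def by meson
  let ?m = "running_max a y"
  have cont: "continuous_on {a..b} y"
    using ac by (rule abs_continuous_on_imp_continuous_on)
  have "(\<Sum>k\<in>d. norm (?m (Sup k) - ?m (Inf k))) < \<epsilon>"
    if d: "d division_of t" "t \<subseteq> {a..b}" "(\<Sum>k\<in>d. Sup k - Inf k) < \<delta>" for d t
  proof -
    have fin: "finite d"
      using d by auto
    have box: "{Inf k..Sup k} = k" and inter: "Inf k \<le> Sup k \<and> a \<le> Inf k \<and> Sup k \<le> b"
      if k: "k \<in> d" for k
    proof -
      obtain u v where "k = {u..v}" "k \<noteq> {}"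
        using division_ofD(3)[OF d(1) k] division_ofD(4)[OF d(1) k] by auto
      then show "{Inf k..Sup k} = k" "Inf k \<le> Sup k \<and> a \<le> Inf k \<and> Sup k \<le> b"
        using subset_trans[OF division_ofD(2)[OF d(1) k] d(2)] by auto
    qed
    \<comment> \<open>The other intervals contribute 0. Strict increase ensures
      \<open>Inf k < r k\<close>, so the shortened intervals \<open>c k\<close> below have nonempty
      interior.\<close>
    define d' where "d' = {k\<in>d. ?m (Inf k) < ?m (Sup k)}"
    have "\<exists>r. r \<in> {Inf k<..Sup k} \<and> ?m (Sup k) = y r" if "k \<in> d'" for k
      using running_max_increase[OF cont, of "Inf k" "Sup k"] inter[of k] that
      by (auto simp: d'_def)
    then obtain r where r: "\<And>k. k \<in> d' \<Longrightarrow> r k \<in> {Inf k<..Sup k} \<and> ?m (Sup k) = y (r k)"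
      by metis
    define c where "c k = {Inf k..r k}" for k
    have c_int: "interior (c k) \<noteq> {}" "c k \<subseteq> k" "Inf (c k) = Inf k" "Sup (c k) = r k" if "k \<in> d'" for k
    proof -
      have *: "Inf k < r k" "r k \<le> Sup k"
        using r[OF that] by auto
      then show "interior (c k) \<noteq> {}" "Inf (c k) = Inf k" "Sup (c k) = r k"
        by (auto simp: c_def)
      have "c k \<subseteq> {Inf k..Sup k}"
        using * by (auto simp: c_def)
      then show "c k \<subseteq> k"
        using box[of k] that by (simp add: d'_def)
    qed
    have disj: "interior (c k) \<inter> interior (c l) = {}" if "k \<in> d'" "l \<in> d'" "k \<noteq> l" for k l
      using division_ofD(5)[OF d(1), of k l] c_int(2)[THEN interior_mono] that by (auto simp: d'_def)
    \<comment> \<open>If \<open>c k = c l\<close> with \<open>k \<noteq> l\<close>, this interval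
      would have an interior disjoint from itself, hence empty.\<close>
    have inj: "inj_on c d'"
      using disj c_int(1) by (metis inf.idem inj_onI)
    have div: "c ` d' division_of \<Union>(c ` d')"
    proof (rule division_ofI)
      show "finite (c ` d')"
        using fin by (simp add: d'_def)
      show "K \<noteq> {}" if "K \<in> c ` d'" for K
        using that c_int(1) by (metis imageE interior_empty)
      show "\<exists>u v. K = cbox u v" if "K \<in> c ` d'" for K
        using that by (auto simp: c_def simp flip: box_real(2))
    qed (use disj in auto)
    have "\<Union>(c ` d') \<subseteq> {a..b}"
    proof -
      have "\<Union>(c ` d') \<subseteq> \<Union>d"
        using c_int(2) by (auto simp: d'_def)
      then show ?thesis
        using d by auto
    qed
    moreover have "(\<Sum>k\<in>c ` d'. Sup k - Inf k) < \<delta>"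
    proof -
      have "(\<Sum>k\<in>c ` d'. Sup k - Inf k) = (\<Sum>k\<in>d'. r k - Inf k)"
        unfolding sum.reindex[OF inj] using c_int by (intro sum.cong) auto
      also have "\<dots> \<le> (\<Sum>k\<in>d'. Sup k - Inf k)"
        using r by (intro sum_mono) auto
      also have "\<dots> \<le> (\<Sum>k\<in>d. Sup k - Inf k)"
        using fin inter by (intro sum_mono2) (auto simp: d'_def)
      finally show ?thesis using d by simp
    qed
    ultimately have *: "(\<Sum>k\<in>c ` d'. norm (y (Sup k) - y (Inf k))) < \<epsilon>"
      by (rule \<delta>[OF div])
    have mono: "?m (Inf k) \<le> ?m (Sup k)" if "k \<in> d" for k
      using running_max_mono[OF cont, of "Inf k" "Sup k"] inter[OF that] by auto
    have "(\<Sum>k\<in>d. norm (?m (Sup k) - ?m (Inf k))) = (\<Sum>k\<in>d'. norm (?m (Sup k) - ?m (Inf k)))"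
      using fin mono by (intro sum.mono_neutral_right) (auto simp: d'_def not_less intro: antisym)
    \<comment> \<open>The running maximum equals \<open>y (r k)\<close> at \<open>Sup k\<close> and
      is at least \<open>y (Inf k)\<close> at \<open>Inf k\<close>, so passing to \<open>y\<close>
      can only enlarge the increment.\<close>
    also have "\<dots> \<le> (\<Sum>k\<in>d'. norm (y (r k) - y (Inf k)))"
    proof (rule sum_mono)
      fix k assume k: "k \<in> d'"
      then have "y (Inf k) \<le> ?m (Inf k)"
        using inter[of k] by (intro running_max_upper[OF cont]) (auto simp: d'_def)
      then show "norm (?m (Sup k) - ?m (Inf k)) \<le> norm (y (r k) - y (Inf k))"
        using r[OF k] k by (auto simp: d'_def)
    qed
    also have "\<dots> = (\<Sum>k\<in>c ` d'. norm (y (Sup k) - y (Inf k)))"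
      unfolding sum.reindex[OF inj] using c_int by (intro sum.cong) auto
    also note *
    finally show ?thesis .
  qed
  with \<open>\<delta> > 0\<close> show "\<exists>\<delta>>0. \<forall>d t. d division_of t \<and> t \<subseteq> {a..b} \<and> (\<Sum>k\<in>d. Sup k - Inf k) < \<delta> \<longrightarrow>
      (\<Sum>k\<in>d. norm (?m (Sup k) - ?m (Inf k))) < \<epsilon>"
    by blast
qed

section \<open>The derivative of the running maximum\<close>

text \<open>These are the only times at which \<open>y\<close> may be differentiable and touch its running maximum
  \<open>m\<close> without \<open>m\<close> being differentiable: \<open>m\<close> is flat to the left, but follows a growing \<open>y\<close> to the
  right.\<close>

definition plateau_ends :: "real \<Rightarrow> real \<Rightarrow> (real \<Rightarrow> real) \<Rightarrow> real set" where
  "plateau_ends a b m = {t\<in>{a..b}. (\<exists>r\<in>{a..<t}. m r = m t) \<and> (\<forall>s\<in>{t<..b}. m t < m s)}"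

text \<open>The plateau before each end \<open>t\<close> contains a rational \<open>q t\<close> with
  \<open>m (q t) = m t\<close>. For ends \<open>s < t\<close> the growth of \<open>m\<close> after
  \<open>s\<close> gives \<open>m s < m t\<close>, so these rationals are distinct.\<close>

lemma countable_plateau_ends:
  assumes "mono_on {a..b} m"
  shows "countable (plateau_ends a b m)"
proof -
  have "\<exists>q\<in>\<rat>. m q = m t" if t: "t \<in> plateau_ends a b m" for t
  proof -
    obtain r where r: "a \<le> r" "r < t" "t \<le> b" "m r = m t"
      using t by (auto simp: plateau_ends_def)
    obtain q where q: "q \<in> \<rat>" "r < q" "q < t"
      using Rats_dense_in_real[OF r(2)] by auto
    have "m r \<le> m q" "m q \<le> m t"
      using r q mono_onD[OF assms, of r q] mono_onD[OF assms, of q t] by auto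
    with r q show ?thesis by (intro bexI[of _ q]) auto
  qed
  then obtain q where q: "\<And>t. t \<in> plateau_ends a b m \<Longrightarrow> q t \<in> \<rat> \<and> m (q t) = m t"
    by metis
  have "inj_on q (plateau_ends a b m)"
  proof (rule linorder_inj_onI')
    fix s t assume "s \<in> plateau_ends a b m" "t \<in> plateau_ends a b m" "s < t"
    then have "m (q s) < m (q t)"
      using q by (auto simp: plateau_ends_def)
    then show "q s \<noteq> q t" by auto
  qed
  moreover have "countable (q ` plateau_ends a b m)"
    using q by (intro countable_subset[OF _ countable_rat]) auto
  ultimately show ?thesis
    by (rule countable_image_inj_on[rotated])
qed

text \<open>The maximum was attained at some \<open>r < t\<close>, and by continuity
  \<open>y\<close> stays below it for a while after \<open>t\<close>; hence the running maximum is
  constant near \<open>t\<close>.\<close>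

lemma running_max_deriv_below:
  assumes cont: "continuous_on {a..b} y" and t: "t \<in> {a..b}"
    and less: "y t < running_max a y t"
  shows "(running_max a y has_real_derivative 0) (at t within {a..b})"
proof -
  let ?m = "running_max a y"
  obtain r where r: "r \<in> {a..t}" "?m t = y r"
    using running_max_attained[OF cont] t by auto
  then have "r < t"
    using less by (cases "r = t") auto
  obtain d where "d > 0" and d: "\<And>s. s \<in> {a..b} \<Longrightarrow> \<bar>s - t\<bar> < d \<Longrightarrow> y s < ?m t"
  proof -
    have "0 < ?m t - y t"
      using less by simp
    then obtain d where "d > 0" "\<And>s. s \<in> {a..b} \<Longrightarrow> dist s t < d \<Longrightarrow> dist (y s) (y t) < ?m t - y t"
      using cont t unfolding continuous_on_iff by blast
    then show thesis
      by (intro that[of d]) (auto simp: dist_real_def abs_less_iff)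
  qed
  \<comment> \<open>The bound \<open>t - r\<close> keeps \<open>s\<close> to the right of the
    maximiser \<open>r\<close>; the bound \<open>d\<close> keeps the values of \<open>y\<close>
    between \<open>t\<close> and \<open>s\<close> below the old maximum.\<close>
  have const: "?m s = ?m t" if s: "s \<in> {a..b}" "dist s t < min d (t - r)" for s
  proof (rule antisym)
    have "r \<le> s"
      using s by (auto simp: dist_real_def)
    then show "?m t \<le> ?m s"
      using running_max_upper[OF cont, of r s] r s by auto
    show "?m s \<le> ?m t"
    proof (rule running_max_least)
      fix w assume w: "w \<in> {a..s}"
      show "y w \<le> ?m t"
      proof (cases "w \<le> t")
        case True
        then show ?thesis using running_max_upper[OF cont, of w t] w t by auto
      next
        case False
        then show ?thesis using d[of w] w s by (auto simp: dist_real_def)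
      qed
    qed (use s in auto)
  qed
  have "((\<lambda>s. ?m t) has_real_derivative 0) (at t within {a..b})"
    by simp
  then show ?thesis
  proof (rule has_field_derivative_transform_within[where d = "min d (t - r)"])
    show "?m t = ?m s" if "s \<in> {a..b}" "dist s t < min d (t - r)" for s
      using const[OF that] by (rule sym)
  qed (use \<open>d > 0\<close> \<open>r < t\<close> t in auto)
qed

text \<open>The first-order expansion of \<open>y\<close> at \<open>t\<close> controls the maximum
  on both sides, except for the upper bound on the left when \<open>D > 0\<close>: there an earlier
  peak of the same height could keep the maximum flat up to \<open>t\<close>. This is what
  \<open>no_end\<close> excludes.\<close>

lemma running_max_deriv_contact:
  assumes cont: "continuous_on {a..b} y" and t: "t \<in> {a..b}"
    and eq: "y t = running_max a y t"
    and deriv: "(y has_real_derivative D) (at t within {a..b})"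
    and no_end: "t \<notin> plateau_ends a b (running_max a y)"
  shows "(running_max a y has_real_derivative max D 0) (at t within {a..b})"
  unfolding has_field_derivative_def has_derivative_within_alt real_norm_def
proof (intro conjI allI impI)
  let ?m = "running_max a y"
  show "bounded_linear ((*) (max D 0))"
    by (rule bounded_linear_mult_right)
  fix \<epsilon> :: real assume "\<epsilon> > 0"
  then obtain d where "d > 0" and d: "\<And>s. s \<in> {a..b} \<Longrightarrow> \<bar>s - t\<bar> < d \<Longrightarrow>
      \<bar>y s - y t - D * (s - t)\<bar> \<le> \<epsilon> * \<bar>s - t\<bar>"
    using deriv unfolding has_field_derivative_def has_derivative_within_alt real_norm_def by blast
  have right: "\<bar>?m s - ?m t - max D 0 * (s - t)\<bar> \<le> \<epsilon> * \<bar>s - t\<bar>"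
    if s: "s \<in> {a..b}" "t \<le> s" "\<bar>s - t\<bar> < d" for s
  proof -
    \<comment> \<open>Values of \<open>y\<close> up to time \<open>t\<close> are at most
      \<open>y t\<close> by contact; later ones are bounded by the expansion.\<close>
    have "?m s \<le> y t + (max D 0 + \<epsilon>) * (s - t)"
    proof (rule running_max_least)
      fix r assume r: "r \<in> {a..s}"
      show "y r \<le> y t + (max D 0 + \<epsilon>) * (s - t)"
      proof (cases "r \<le> t")
        case True
        have "0 \<le> (max D 0 + \<epsilon>) * (s - t)"
          using s \<open>\<epsilon> > 0\<close> by (intro mult_nonneg_nonneg) auto
        then show ?thesis
          using running_max_upper[OF cont, of r t] True r t eq by auto
      next
        case False
        have "y r \<le> y t + (D + \<epsilon>) * (r - t)"
          using d[of r] False r s t by (auto simp: algebra_simps)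
        also have "(D + \<epsilon>) * (r - t) \<le> (max D 0 + \<epsilon>) * (s - t)"
          using False r \<open>\<epsilon> > 0\<close> by (intro mult_mono) auto
        finally show ?thesis by simp
      qed
    qed (use s in auto)
    moreover have "?m s \<ge> y t + (max D 0 - \<epsilon>) * (s - t)"
    proof (cases "D \<ge> 0")
      case True
      have "y s \<le> ?m s"
        using running_max_upper[OF cont, of s s] s by auto
      then show ?thesis
        using True d[of s] s by (auto simp: algebra_simps max_def abs_le_iff)
    next
      case False
      have "?m t \<le> ?m s" "0 \<le> \<epsilon> * (s - t)"
        using running_max_mono[OF cont, of t s] s t \<open>\<epsilon> > 0\<close> by auto
      with False show ?thesis
        using eq by (auto simp: algebra_simps max_def)
    qed
    ultimately show ?thesis
      using s eq by (auto simp: algebra_simps abs_le_iff)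
  qed
  \<comment> \<open>As \<open>s - t\<close> is nonpositive, replacing \<open>D\<close> by
    \<open>max D 0\<close> only weakens the lower bound that \<open>y\<close> provides.\<close>
  have left_lower: "?m s \<ge> y t + (max D 0 + \<epsilon>) * (s - t)"
    if s: "s \<in> {a..b}" "s \<le> t" "\<bar>s - t\<bar> < d" for s
  proof -
    have "y s \<le> ?m s"
      using running_max_upper[OF cont, of s s] s by auto
    moreover have "max D 0 * (s - t) \<le> D * (s - t)"
      using s by (intro mult_right_mono_neg) auto
    ultimately show ?thesis
      using d[of s] s by (auto simp: algebra_simps abs_le_iff)
  qed
  have "\<exists>d'>0. \<forall>s\<in>{a..b}. s < t \<longrightarrow> \<bar>s - t\<bar> < d' \<longrightarrow> ?m s \<le> y t + (max D 0 - \<epsilon>) * (s - t)"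
  proof (cases "D \<le> \<epsilon> \<or> t = a")
    case True
    \<comment> \<open>Any \<open>s < t\<close> in the interval rules out \<open>t = a\<close>, so
      \<open>D \<le> \<epsilon>\<close>. The slope \<open>max D 0 - \<epsilon>\<close> is then
      nonpositive and monotonicity suffices.\<close>
    have "?m s \<le> y t + (max D 0 - \<epsilon>) * (s - t)" if "s \<in> {a..b}" "s < t" for s
    proof -
      have "?m s \<le> y t"
        using running_max_mono[OF cont, of s t] that t eq by auto
      moreover have "0 \<le> (max D 0 - \<epsilon>) * (s - t)"
        using True that \<open>\<epsilon> > 0\<close> by (intro mult_nonpos_nonpos) auto
      ultimately show ?thesis by simp
    qed
    then show ?thesis
      by (intro exI[of _ 1]) auto
  next
    case False
    then have D: "\<epsilon> < D" "a < t" using t by auto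
    \<comment> \<open>The maximum grows strictly after \<open>t\<close> because \<open>y\<close>
      does. Since \<open>t\<close> is not a plateau end, the maximum cannot have been flat before
      \<open>t\<close>.\<close>
    have "?m t < ?m s" if s: "s \<in> {t<..b}" for s
    proof -
      \<comment> \<open>The expansion may fail at a distant \<open>s\<close>, so the growth of
        \<open>y\<close> is read off at an earlier time \<open>r\<close> within its range.\<close>
      define r where "r = min s (t + d / 2)"
      have r: "t < r" "r \<le> s" "\<bar>r - t\<bar> < d" "r \<in> {a..b}"
        using s t \<open>d > 0\<close> by (auto simp: r_def min_def)
      have "0 < (D - \<epsilon>) * (r - t)"
        using D r by simp
      also have "\<dots> \<le> y r - y t"
        using d[of r] r by (auto simp: algebra_simps abs_le_iff)
      also have "y r \<le> ?m s"
        using running_max_upper[OF cont, of r s] r s by auto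
      finally show ?thesis using eq by simp
    qed
    then have strict: "?m r \<noteq> ?m t" if "r \<in> {a..<t}" for r
      using no_end t that by (auto simp: plateau_ends_def)
    \<comment> \<open>Between \<open>c\<close> and \<open>t\<close> the expansion of
      \<open>y\<close> holds; up to \<open>c\<close> all values are at most the maximum at
      \<open>c\<close>, which is strictly below that at \<open>t\<close>.\<close>
    define c where "c = max a (t - d / 2)"
    have c: "a \<le> c" "c < t" "t - d < c"
      using D \<open>d > 0\<close> by (auto simp: c_def)
    then have mc: "?m c < ?m t"
      using running_max_mono[OF cont, of c t] strict[of c] t by auto
    \<comment> \<open>The radius is the time in which a line of slope \<open>D\<close> through
      \<open>(t, y t)\<close> falls, going left, to the maximum at \<open>c\<close>; for nearer
      \<open>s\<close> the line stays above all values of \<open>y\<close> up to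
      \<open>c\<close>.\<close>
    have "?m s \<le> y t + (D - \<epsilon>) * (s - t)"
      if s: "s \<in> {a..b}" "s < t" "\<bar>s - t\<bar> < (?m t - ?m c) / D" for s
    proof (rule running_max_least)
      fix r assume r: "r \<in> {a..s}"
      show "y r \<le> y t + (D - \<epsilon>) * (s - t)"
      proof (cases "r \<le> c")
        case True
        then have "y r \<le> ?m c"
          using running_max_upper[OF cont, of r c] r c t by auto
        moreover have "D * (t - s) \<le> ?m t - ?m c"
          using s D \<open>\<epsilon> > 0\<close> by (simp add: field_simps)
        moreover have "0 \<le> \<epsilon> * (t - s)"
          using s \<open>\<epsilon> > 0\<close> by simp
        ultimately show ?thesis
          using eq by (simp add: algebra_simps)
      next
        case False
        then have "y r \<le> y t + (D - \<epsilon>) * (r - t)"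
          using d[of r] r s c t by (auto simp: algebra_simps abs_le_iff)
        also have "(D - \<epsilon>) * (r - t) \<le> (D - \<epsilon>) * (s - t)"
          using D r by (intro mult_left_mono) auto
        finally show ?thesis by simp
      qed
    qed (use s in auto)
    moreover have "(?m t - ?m c) / D > 0"
      using mc D \<open>\<epsilon> > 0\<close> by simp
    moreover have "max D 0 = D"
      using D \<open>\<epsilon> > 0\<close> by simp
    ultimately show ?thesis by auto
  qed
  then obtain d' where "d' > 0" and left_upper: "\<And>s. s \<in> {a..b} \<Longrightarrow> s < t \<Longrightarrow> \<bar>s - t\<bar> < d' \<Longrightarrow>
      ?m s \<le> y t + (max D 0 - \<epsilon>) * (s - t)"
    by auto
  have "\<bar>?m s - ?m t - max D 0 * (s - t)\<bar> \<le> \<epsilon> * \<bar>s - t\<bar>"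
    if s: "s \<in> {a..b}" "\<bar>s - t\<bar> < min d d'" for s
  proof (cases "t \<le> s")
    case True
    then show ?thesis using right s by auto
  next
    case False
    then show ?thesis
      using left_lower[of s] left_upper[of s] s eq by (auto simp: algebra_simps abs_le_iff)
  qed
  with \<open>d > 0\<close> \<open>d' > 0\<close> show "\<exists>d>0. \<forall>s\<in>{a..b}. \<bar>s - t\<bar> < d \<longrightarrow>
      \<bar>?m s - ?m t - max D 0 * (s - t)\<bar> \<le> \<epsilon> * \<bar>s - t\<bar>"
    by (intro exI[of _ "min d d'"]) auto
qed

section \<open>Comparison of the costs of the two problems\<close>

text \<open>Since \<open>v \<le> 1\<close>, the derivative of \<open>z\<close> is nonnegative almost
  everywhere, so \<open>y t \<le> z t \<le> z T\<close>.\<close>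

lemma admissible_P1_SUP_le:
  assumes adm: "admissible_P1 U f g T x0 y0 u v x y z" and T: "T > 0"
  shows "(SUP t\<in>{0..T}. y t) \<le> z T"
proof (rule cSUP_least)
  fix t assume t: "t \<in> {0..T}"
  have v: "v t \<in> {0..1}" if "t \<in> {0..T}" for t
    using adm that by (auto simp: admissible_P1_def controls_def)
  have "AE t in lebesgue_on {0..T}.
      (z has_real_derivative max (g (x t) (y t) (u t)) 0 * (1 - v t)) (at t within {0..T})"
    using adm by (simp add: admissible_P1_def extended_trajectory_def)
  \<comment> \<open>\<open>AE_space\<close> supplies \<open>t \<in> {0..T}\<close>, the only times
    at which the range of \<open>v\<close> is known.\<close>
  with AE_space have "AE t in lebesgue_on {0..T}. \<exists>D\<ge>0. (z has_real_derivative D) (at t within {0..T})"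
  proof eventually_elim
    case (elim t)
    then have "0 \<le> max (g (x t) (y t) (u t)) 0 * (1 - v t)"
      using v[of t] by (intro mult_nonneg_nonneg) auto
    with elim show ?case by blast
  qed
  moreover have "abs_continuous_on {0..T} z"
    using adm by (simp add: admissible_P1_def extended_trajectory_def)
  ultimately have "z t \<le> z T"
    using t by (intro abs_continuous_on_mono[of 0 T z]) auto
  moreover have "y t \<le> z t"
    using adm t by (auto simp: admissible_P1_def)
  ultimately show "y t \<le> z T" by simp
qed (use T in auto)

text \<open>Below the maximum \<open>v = 1\<close> matches the derivative 0; at contact
  \<open>v = 0\<close> matches the positive part of \<open>g\<close>. The exceptional times are the
  countably many plateau ends and the null set where \<open>y\<close> violates its equation.\<close>

lemma running_max_admissible_P1:
  assumes traj: "trajectory f g T x0 y0 u x y" and u: "u \<in> controls T U" and T: "T > 0"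
  shows "\<exists>v. admissible_P1 U f g T x0 y0 u v x y (running_max 0 y)"
proof -
  let ?m = "running_max 0 y"
  define v where "v = (indicator {t. y t < ?m t} :: real \<Rightarrow> real)"
  have y: "abs_continuous_on {0..T} y" "y 0 = y0"
    using traj by (auto simp: trajectory_def is_solution_def)
  then have cont: "continuous_on {0..T} y"
    by (intro abs_continuous_on_imp_continuous_on)
  have m: "abs_continuous_on {0..T} ?m"
    using y by (intro abs_continuous_on_running_max)
  have le: "y t \<le> ?m t" if "t \<in> {0..T}" for t
    using that by (intro running_max_upper[OF cont]) auto
  have "v \<in> controls T {0..1}"
  proof -
    have "continuous_on {0..T} ?m"
      using m by (rule abs_continuous_on_imp_continuous_on)
    then have [measurable]: "y \<in> borel_measurable (lebesgue_on {0..T})"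
      "?m \<in> borel_measurable (lebesgue_on {0..T})"
      using cont by (auto intro: continuous_imp_measurable_on_sets_lebesgue)
    have "v = (\<lambda>t. if y t < ?m t then 1 else 0)"
      by (auto simp: v_def indicator_def)
    also have "\<dots> \<in> borel_measurable (lebesgue_on {0..T})"
      by measurable
    finally show ?thesis
      by (auto simp: controls_def v_def indicator_def)
  qed
  moreover have "?m 0 = y0"
    using y by (simp add: running_max_def)
  moreover have "AE t in lebesgue_on {0..T}.
      (?m has_real_derivative max (g (x t) (y t) (u t)) 0 * (1 - v t)) (at t within {0..T})"
  proof -
    have "mono_on {0..T} ?m"
      by (intro mono_onI running_max_mono[OF cont]) auto
    then have "countable (plateau_ends 0 T ?m)"
      by (rule countable_plateau_ends)
    then have "negligible (plateau_ends 0 T ?m)"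
      by (simp add: negligible_iff_null_sets countable_imp_null_set_lborel null_sets_completionI)
    then have "AE t in lebesgue_on {0..T}. t \<notin> plateau_ends 0 T ?m"
      by (subst AE_lebesgue_on_iff_negligible) (auto intro: negligible_subset)
    moreover have "AE t in lebesgue_on {0..T}.
        (y has_real_derivative g (x t) (y t) (u t)) (at t within {0..T})"
      using traj unfolding trajectory_def is_solution_def by auto
    ultimately show ?thesis
      using AE_space
    proof eventually_elim
      case (elim t)
      show ?case
      proof (cases "y t < ?m t")
        case True
        then show ?thesis
          using running_max_deriv_below[OF cont, of t] elim by (simp add: v_def)
      next
        case False
        then show ?thesis
          using running_max_deriv_contact[OF cont, of t] le[of t] elim by (simp add: v_def)
      qed
    qed
  qed
  ultimately show ?thesis
    using traj u m le by (auto simp: admissible_P1_def extended_trajectory_def)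
qed

section \<open>Transfer of optimality\<close>

theorem proposition3p2:
  fixes D :: "((real^'n) \<times> real) set" and U :: "(real^'p) set"
    and f :: "real^'n \<Rightarrow> real \<Rightarrow> real^'p \<Rightarrow> real^'n"
    and g :: "real^'n \<Rightarrow> real \<Rightarrow> real^'p \<Rightarrow> real"
    and T :: real and x0 :: "real^'n" and y0 :: real
  assumes domain: "open D" "connected D" "D \<noteq> {}"
    and invariant: "invariant_domain D U f g"
    and U: "U \<noteq> {}" "compact U"
    and C1_f: "C1_on (\<lambda>((x, y), u). f x y u) (D \<times> U)"
    and C1_g: "C1_on (\<lambda>((x, y), u). g x y u) (D \<times> U)"
    and linear_growth:
      "\<exists>C>0. \<forall>x y u. (x, y) \<in> D \<and> u \<in> U \<longrightarrow>
         norm (f x y u) + \<bar>g x y u\<bar> \<le> C * (1 + norm x + \<bar>y\<bar>)"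
    and T: "T > 0"
    and init: "(x0, y0) \<in> D"
  shows "(\<forall>us vs. optimal_P1 U f g T x0 y0 us vs \<longrightarrow> optimal_P U f g T x0 y0 us) \<and>
         (\<forall>us vs. optimal_P U f g T x0 y0 us \<and> optimal_P1_fixed_control U f g T x0 y0 us vs \<longrightarrow>
            optimal_P1 U f g T x0 y0 us vs)"
proof (intro conjI allI impI)
  fix us vs
  assume "optimal_P1 U f g T x0 y0 us vs"
  then obtain x y z where adm: "admissible_P1 U f g T x0 y0 us vs x y z"
    and opt: "\<And>u' v' x' y' z'. admissible_P1 U f g T x0 y0 u' v' x' y' z' \<Longrightarrow> z T \<le> z' T"
    unfolding optimal_P1_def by blast
  have "us \<in> controls T U" "trajectory f g T x0 y0 us x y"
    using adm by (auto simp: admissible_P1_def extended_trajectory_def)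
  moreover have "(SUP t\<in>{0..T}. y t) \<le> (SUP t\<in>{0..T}. y' t)"
    if "u' \<in> controls T U" "trajectory f g T x0 y0 u' x' y'" for u' x' y'
  proof -
    \<comment> \<open>The running maximum turns any competitor for the original problem into one for
      the extended problem with the same cost.\<close>
    from that T obtain v' where "admissible_P1 U f g T x0 y0 u' v' x' y' (running_max 0 y')"
      using running_max_admissible_P1 by metis
    then have "z T \<le> running_max 0 y' T"
      by (rule opt)
    with admissible_P1_SUP_le[OF adm T] show ?thesis
      by (simp add: running_max_def)
  qed
  ultimately show "optimal_P U f g T x0 y0 us"
    unfolding optimal_P_def by blast
next
  fix us vs
  assume opt: "optimal_P U f g T x0 y0 us \<and> optimal_P1_fixed_control U f g T x0 y0 us vs"
  then obtain x y where traj: "us \<in> controls T U" "trajectory f g T x0 y0 us x y"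
    and opt_P: "\<And>u' x' y'. u' \<in> controls T U \<Longrightarrow> trajectory f g T x0 y0 u' x' y' \<Longrightarrow>
      (SUP t\<in>{0..T}. y t) \<le> (SUP t\<in>{0..T}. y' t)"
    unfolding optimal_P_def by blast
  from opt obtain x1 y1 z1 where adm: "admissible_P1 U f g T x0 y0 us vs x1 y1 z1"
    and opt_v: "\<And>v' x' y' z'. admissible_P1 U f g T x0 y0 us v' x' y' z' \<Longrightarrow> z1 T \<le> z' T"
    unfolding optimal_P1_fixed_control_def by blast
  have "z1 T \<le> z' T" if adm': "admissible_P1 U f g T x0 y0 u' v' x' y' z'" for u' v' x' y' z'
  proof -
    \<comment> \<open>The pairs \<open>x\<close>, \<open>y\<close> and \<open>x1\<close>,
      \<open>y1\<close> come from separate witnesses. As \<open>opt_v\<close> ranges over all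
      trajectories of \<open>us\<close>, it applies directly to the running maximum of
      \<open>y\<close>.\<close>
    obtain v where "admissible_P1 U f g T x0 y0 us v x y (running_max 0 y)"
      using running_max_admissible_P1 traj T by metis
    then have "z1 T \<le> running_max 0 y T"
      by (rule opt_v)
    also have "\<dots> = (SUP t\<in>{0..T}. y t)"
      by (rule running_max_def)
    also have "\<dots> \<le> (SUP t\<in>{0..T}. y' t)"
      using adm' by (intro opt_P) (auto simp: admissible_P1_def extended_trajectory_def)
    also have "\<dots> \<le> z' T"
      using adm' T by (rule admissible_P1_SUP_le)
    finally show ?thesis .
  qed
  with adm show "optimal_P1 U f g T x0 y0 us vs"
    unfolding optimal_P1_def by blast
qed

end
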